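(* Let $A$ be a simple unital $C^*$-algebra. A linear subspace $U$ of $A$ is a Lie ideal of $A$ if and only if $(1+x)U(1-x)\subseteq U$ for all $x\in N_2$.
   Context: $N_2$ is the set of nilpotent elements of $A$ of order exactly $2$ (i.e. $x^2=0$, $x\ne0$). A linear subspace $U$ of $A$ (not necessarily closed) is a Lie ideal of $A$ if $[u,a]=ua-au\in U$ for all $u\in U$, $a\in A$. *)

theory Defs
  imports "HOL-Analysis.Analysis"
begin

text \<open>
  The library provides only real normed algebras, so the complex structure is added here; the axiom
  \<open>scaleC_of_real\<close> makes it extend the inherited real one. Submultiplicativity of the norm and
  completeness come from the parent classes. These also give \<open>0 \<noteq> 1\<close> and \<open>norm 1 = 1\<close>; the latter
  holds automatically in every nonzero unital C*-algebra.
\<close>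

class unital_cstar_algebra = real_normed_algebra_1 + banach +
  fixes scaleC :: "complex \<Rightarrow> 'a \<Rightarrow> 'a"  (infixr "*\<^sub>C" 75)
    and star :: "'a \<Rightarrow> 'a"
  assumes scaleC_add_right: "c *\<^sub>C (x + y) = c *\<^sub>C x + c *\<^sub>C y"
    and scaleC_add_left: "(c + d) *\<^sub>C x = c *\<^sub>C x + d *\<^sub>C x"
    and scaleC_scaleC: "c *\<^sub>C (d *\<^sub>C x) = (c * d) *\<^sub>C x"
    and scaleC_of_real: "complex_of_real r *\<^sub>C x = r *\<^sub>R x"
    and mult_scaleC_left: "(c *\<^sub>C x) * y = c *\<^sub>C (x * y)"
    and mult_scaleC_right: "x * (c *\<^sub>C y) = c *\<^sub>C (x * y)"
    and norm_scaleC: "norm (c *\<^sub>C x) = cmod c * norm x"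
    and star_star: "star (star x) = x"
    and star_add: "star (x + y) = star x + star y"
    and star_scaleC: "star (c *\<^sub>C x) = cnj c *\<^sub>C star x"
    and star_mult: "star (x * y) = star y * star x"
    and cstar_identity: "norm (star x * x) = (norm x)\<^sup>2"

global_interpretation complex_vector:
  vector_space "scaleC :: complex \<Rightarrow> 'a \<Rightarrow> 'a::unital_cstar_algebra"
proof
  fix c d :: complex and x y :: 'a
  show "c *\<^sub>C (x + y) = c *\<^sub>C x + c *\<^sub>C y" by (rule scaleC_add_right)
  show "(c + d) *\<^sub>C x = c *\<^sub>C x + d *\<^sub>C x" by (rule scaleC_add_left)
  show "c *\<^sub>C d *\<^sub>C x = (c * d) *\<^sub>C x" by (rule scaleC_scaleC)
  show "1 *\<^sub>C x = x" using scaleC_of_real[of 1 x] by simp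
qed

abbreviation csubspace :: "'a::unital_cstar_algebra set \<Rightarrow> bool" where
  "csubspace \<equiv> module.subspace scaleC"

definition two_sided_ideal :: "'a::unital_cstar_algebra set \<Rightarrow> bool" where
  "two_sided_ideal I \<longleftrightarrow> csubspace I \<and> (\<forall>x\<in>I. \<forall>a. a * x \<in> I \<and> x * a \<in> I)"

text \<open>
  As usual for C*-algebras, simplicity refers to closed two-sided ideals; the algebra is nonzero
  because \<open>0 \<noteq> 1\<close>.
\<close>

definition simple_cstar_algebra :: "'a::unital_cstar_algebra itself \<Rightarrow> bool" where
  "simple_cstar_algebra _ \<longleftrightarrow>
    (\<forall>I :: 'a set. two_sided_ideal I \<and> closed I \<longrightarrow> I = {0} \<or> I = UNIV)"

definition N2 :: "'a::unital_cstar_algebra set" where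
  "N2 = {x. x\<^sup>2 = 0 \<and> x \<noteq> 0}"

definition lie_ideal :: "'a::unital_cstar_algebra set \<Rightarrow> bool" where
  "lie_ideal U \<longleftrightarrow> csubspace U \<and> (\<forall>u\<in>U. \<forall>a. u * a - a * u \<in> U)"

end

theory Submission
  imports Defs "HOL-Computational_Algebra.Formal_Power_Series"
begin

text \<open>
  Write $[a,b] = ab - ba$. For $x^2 = 0$ one has $(1+x)u(1-x) = u - [u,x] - xux$ and
  $[[u,x],x] = -2xux$. So a Lie ideal is invariant under these conjugations; conversely,
  comparing $x$ with $-x$ shows that an invariant subspace $U$ satisfies $[U,T] \<subseteq> U$, where
  $T$ is the linear span of the square-zero elements. It remains to pass from $T$ to all of $A$.

  The first step is $[A,A] \<subseteq> T$. If $A$ is noncommutative, some self-adjoint $h$ is not a scalar,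
  and functional calculus, applied to ramp functions with decreasing thresholds, gives elements
  $e_0, \<dots>, e_8$ with $e_i e_j = e_j e_i = e_i$ for $i < j$, $e_0 \<noteq> 0$ and $e_8 \<noteq> 1$
  (\<open>chain_exists\<close>). The set $S$ of all $s$ with $[s,A] \<subseteq> T$ is a subalgebra
  because $[st,a] = [s,ta] + [t,as]$. If $p$ and $q$ have mutually orthogonal local units, then
  $pAq \<subseteq> S$ (\<open>corner_in_transporter\<close>), and the chain provides enough such corners to
  generate $A$, since $A$ has no proper ideals (\<open>commutators_in_span_square_zero\<close>).

  The second step is Herstein's theory of Lie ideals of $[A,A]$ in a simple algebra: if
  $[U,[A,A]] \<subseteq> U$, then $U$ is central or contains $[A,A]$, and in both cases it is a Lie ideal.
  Here one applies the same construction to $U$: the set of all $s$ with $[s,A] \<subseteq> U$ is a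
  subalgebra that is invariant under $[A,A]$ and contains $[U,U]$. Such a subalgebra is everything
  or central (\<open>proper_invariant_subalgebra_central\<close>); if it is everything, then
  $[A,A] \<subseteq> U$; if it is central, then $[U,U]$ is central and this forces $U$ itself to be central
  (\<open>central_if_commutators_central\<close>).

  The functional calculus reduces to the absolute value of a self-adjoint contraction $h$, namely
  $|h| = \<surd>(1 - (1 - h^2))$ with the binomial series for the square root. The series converges
  because $\<parallel>1 - h^2\<parallel> \<le> 1$ (\<open>norm_one_minus_square_le\<close>). Its coefficients also show
  that $\<parallel>1 - |h|\<parallel> \<le> 1$, and this inequality plays the part of positivity of $|h|$ in the proof that
  positive and negative parts are orthogonal (\<open>pos_neg_orthogonal\<close>).
\<close>

section \<open>Simple algebras\<close>

definition comm :: "'a::ring \<Rightarrow> 'a \<Rightarrow> 'a" where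
  "comm a b = a * b - b * a"

text \<open>
  Scalar multiples are multiples by $c \<cdot> 1$, so closure under addition and under multiplication
  from both sides already gives a subspace, over whichever field of scalars.
\<close>

definition ring_ideal :: "'a::ring_1 set \<Rightarrow> bool" where
  "ring_ideal I \<longleftrightarrow> 0 \<in> I \<and> (\<forall>x\<in>I. \<forall>y\<in>I. x + y \<in> I) \<and> (\<forall>x\<in>I. \<forall>a. a * x \<in> I \<and> x * a \<in> I)"

locale simple_algebra =
  fixes type :: "'a::real_algebra_1 itself"
  assumes ideal_trivial: "\<And>I::'a set. ring_ideal I \<Longrightarrow> I = {0} \<or> I = UNIV"
begin

lemma ideal_with_nonzero_element:
  fixes I :: "'a set"
  assumes "ring_ideal I" "x \<in> I" "x \<noteq> 0"
  shows "y \<in> I"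
  using ideal_trivial[OF assms(1)] assms(2,3) by auto

text \<open>The $x$ with $aAx = 0$ form an ideal.\<close>

lemma primeness:
  fixes a b :: 'a
  assumes "\<And>c. a * c * b = 0"
  shows "a = 0 \<or> b = 0"
proof (rule disjCI)
  assume "b \<noteq> 0"
  let ?I = "{x. \<forall>c. a * c * x = 0}"
  have "ring_ideal ?I"
    unfolding ring_ideal_def
    by (auto simp: distrib_left) (metis mult.assoc, metis mult.assoc mult_zero_left)
  then have "1 \<in> ?I"
    using ideal_with_nonzero_element[of ?I b 1] assms \<open>b \<noteq> 0\<close> by simp
  then have "a * 1 * 1 = 0" by blast
  then show "a = 0" by simp
qed

text \<open>
  The $x$ such that $laxbr$ lies in $S$ for all $a$ and $b$ form an ideal, so one nonzero such $x$
  may be replaced by $1$.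
\<close>

lemma fill_middle:
  fixes S :: "'a set"
  assumes S: "subspace S" and "x \<noteq> 0" and mem: "\<And>a b. l * a * x * b * r \<in> S"
  shows "l * a * r \<in> S"
proof -
  let ?I = "{x. \<forall>a b. l * a * x * b * r \<in> S}"
  have "ring_ideal ?I"
    unfolding ring_ideal_def
    using S by (auto simp: distrib_left distrib_right subspace_add subspace_0) (metis mult.assoc)+
  then have "1 \<in> ?I"
    using ideal_with_nonzero_element[of ?I x 1] mem \<open>x \<noteq> 0\<close> by blast
  then have "l * a * 1 * 1 * r \<in> S" by blast
  then show ?thesis by simp
qed

section \<open>Herstein's lemmas on inner derivations\<close>

text \<open>
  From $[a,ab] = a[a,b]$ one gets $[u,a][a,b] = 0$; expanding this for products $b = cu$ yields
  $[u,a] A [a,u] = 0$, and primeness applies.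
\<close>

lemma central_if_commutes_with_commutators:
  fixes u :: 'a
  assumes L: "\<And>a b. comm u (comm a b) = 0"
  shows "comm u a = 0"
proof -
  have 1: "comm u a * comm a b = 0" for b
  proof -
    have "comm u a * comm a b = comm u (comm a (a * b)) - a * comm u (comm a b)"
      by (simp add: comm_def algebra_simps)
    then show ?thesis using L by simp
  qed
  have "comm u a * c * comm a u = 0" for c
  proof -
    have "comm u a * c * comm a u = comm u a * comm a (c * u) - comm u a * comm a c * u"
      by (simp add: comm_def algebra_simps)
    then show ?thesis using 1 by simp
  qed
  then have "comm u a = 0 \<or> comm a u = 0" by (rule primeness)
  then show ?thesis by (auto simp: comm_def)
qed

text \<open>
  Put $D = [u,\<cdot>]$. Since $Da$ is a commutator, $D^3 = 0$. The Leibniz rule applied to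
  $D^2[a,ub] = 0$ and to $D^3(ab) = 0$ gives two different linear relations between $D^2a\,Db$ and
  $Da\,D^2b$, so both products vanish. Primeness then yields $D^2 = 0$, after which
  $0 = D^2(ab) = 2\,Da\,Db$ yields $D = 0$ in the same way.
\<close>

lemma central_if_double_comm_kills_commutators:
  fixes u :: 'a
  assumes L: "\<And>a b. comm u (comm u (comm a b)) = 0"
  shows "comm u a = 0"
proof -
  define D where "D = comm u"
  have D_mult: "D (a * b) = D a * b + a * D b" for a b
    by (simp add: D_def comm_def algebra_simps)
  have D_add: "D (a + b) = D a + D b" for a b by (simp add: D_def comm_def algebra_simps)
  have D_diff: "D (a - b) = D a - D b" for a b by (simp add: D_def comm_def algebra_simps)
  have D_minus: "D (- b) = - D b" for b by (simp add: D_def comm_def algebra_simps)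
  have D_0: "D 0 = 0" by (simp add: D_def comm_def)
  have D_u: "D u = 0" by (simp add: D_def comm_def)
  have D3: "D (D (D a)) = 0" for a
    using L[of u a] by (simp add: D_def)
  have twice: "D (D a) * D b + D (D a) * D b + D a * D (D b) = 0" for a b
  proof -
    have "comm a (u * b) = u * comm a b - D a * b" by (simp add: D_def comm_def algebra_simps)
    then have "D (D (u * comm a b - D a * b)) = 0" using L[of a "u * b"] by (simp add: D_def)
    moreover have "D (D (comm a b)) = 0" using L by (simp add: D_def)
    ultimately show ?thesis
      by (simp add: D_mult D_diff D_add D_u D3 D_0 algebra_simps D_minus)
         (metis (no_types, lifting) add.commute add.assoc add_eq_0_iff minus_add_distrib)
  qed
  have thrice: "D (D a) * D b + D a * D (D b) = 0" for a b
  proof -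
    have triple: "3 *\<^sub>R x = x + x + x" for x :: 'a
      using scaleR_left_distrib[of 2 1 x] by (simp add: scaleR_2)
    have "D (D (D (a * b))) = 3 *\<^sub>R (D (D a) * D b + D a * D (D b))"
      by (simp add: triple D_mult D_add D3 algebra_simps)
    then show ?thesis using D3[of "a * b"] by simp
  qed
  have DD_D: "D (D a) * D b = 0" for a b
    using twice[of a b] thrice[of a b] by (simp add: add.assoc)
  have "D (D a) * c * D b = 0" for a b c
  proof -
    have "D (D a) * c * D b = D (D a) * D (c * b) - D (D a) * D c * b"
      by (simp add: D_mult algebra_simps)
    then show ?thesis using DD_D by simp
  qed
  then have "D (D a) = 0 \<or> D b = 0" for a b by (rule primeness)
  then have DD: "D (D a) = 0" for a by (metis D_0)
  have D_D: "D a * D b = 0" for a b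
  proof -
    have "D (D (a * b)) = 2 *\<^sub>R (D a * D b)" using DD[of a] DD[of b]
      by (simp add: D_mult D_add scaleR_2)
    then show ?thesis using DD[of "a * b"] by simp
  qed
  have "D a * c * D a = 0" for c
  proof -
    have "D a * c * D a = D a * D (c * a) - D a * D c * a" by (simp add: D_mult algebra_simps)
    then show ?thesis using D_D by simp
  qed
  then have "D a = 0" using primeness by blast
  then show ?thesis by (simp add: D_def)
qed

text \<open>
  Suppose that $S \<noteq> A$ and $A$ is noncommutative. A left ideal $Ay \<subseteq> S$ would produce a
  two-sided ideal inside $S$, so $y = 0$. The elements $y = [s,s'][t,s]$ with
  $s, s', t \<in> S$ do satisfy $Ay \<subseteq> S$, hence vanish. Therefore a commutator $m$ of elements of $S$
  satisfies $mSm = 0$. The invariance of $S$ shows that $S$ contains many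
  elements $mambm$, and bracketing these twice with $[A,A]$ forces $m = 0$.
  So $S$ is commutative. Then $[s,[s,[a,b]]] = 0$ for $s \<in> S$, and $s$ is central.
\<close>

lemma proper_invariant_subalgebra_central:
  fixes S :: "'a set"
  assumes sub: "subspace S" and mult: "\<And>s t. s \<in> S \<Longrightarrow> t \<in> S \<Longrightarrow> s * t \<in> S"
    and inv: "\<And>s a b. s \<in> S \<Longrightarrow> comm s (comm a b) \<in> S"
    and proper: "S \<noteq> UNIV" and "s \<in> S"
  shows "comm s a = 0"
proof (cases "\<forall>a b::'a. comm a b = 0")
  case False
  note [simp] = subspace_add[OF sub] subspace_diff[OF sub] subspace_neg[OF sub] subspace_scale[OF sub]
  have no_ideal: "x = 0" if "\<And>a b. a * x * b \<in> S" for x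
  proof (rule ccontr)
    assume "x \<noteq> 0"
    then have "1 * a * 1 \<in> S" for a
      using fill_middle[OF sub, of x 1 1 a] that by simp
    with proper show False by auto
  qed
  \<comment> \<open>If $Ay \<subseteq> S$, then invariance gives $Ay[c,d] \<subseteq> S$. For commutators $c$, $d$ this
      upgrades to $AyA[c,d]A \<subseteq> S$, a two-sided ideal, so $yA[c,d] = 0$ by the choice of $S$.\<close>
  have no_left_ideal: "y = 0" if y: "\<And>a. a * y \<in> S" for y
  proof -
    have right_L: "a * (y * comm c d) \<in> S" if y: "\<And>a. a * y \<in> S" for a c d y
    proof -
      have "a * (y * comm c d) = comm (a * y) (comm c d) + (comm c d * a) * y"
        by (simp add: comm_def algebra_simps)
      then show ?thesis using inv[OF y] y by (metis subspace_add[OF sub])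
    qed
    have L1: "e * (y * (c * comm b d)) \<in> S" if "b = comm b1 b2" for b b1 b2 c d e
    proof -
      have "e * (y * (c * comm b d)) =
          e * (y * comm (c * b) d) - e * (y * comm c d * b)"
        by (simp add: comm_def algebra_simps)
      moreover have "e * (y * comm c d * b) \<in> S"
        unfolding that by (intro right_L y)
      ultimately show ?thesis using right_L[OF y] by simp
    qed
    have "y * b * comm (comm c1 c2) (comm d1 d2) = 0" for b c1 c2 d1 d2 :: 'a
    proof (rule no_ideal)
      fix e a
      let ?c = "comm c1 c2" and ?d = "comm d1 d2"
      have "e * (y * b * comm ?c ?d) * a =
          e * (y * (b * comm ?c (?d * a))) - e * (y * ((b * ?d) * comm ?c a))"
        by (simp add: comm_def algebra_simps)
      then show "e * (y * b * comm ?c ?d) * a \<in> S"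
        using L1[OF refl] by simp
    qed
    then have "y = 0 \<or> comm (comm c1 c2) (comm d1 d2) = 0" for c1 c2 d1 d2 :: 'a
      by (rule primeness)
    moreover have False if "\<And>c1 c2 d1 d2::'a. comm (comm c1 c2) (comm d1 d2) = 0"
    proof -
      have "comm (comm c1 c2) a = 0" for c1 c2 a :: 'a
        by (rule central_if_commutes_with_commutators) (rule that)
      then have "comm u (comm c1 c2) = 0" for c1 c2 u :: 'a
        by (metis comm_def right_minus_eq)
      then have "comm u a = 0" for u a :: 'a
        by (rule central_if_commutes_with_commutators)
      with False show False by blast
    qed
    ultimately show ?thesis by blast
  qed
  \<comment> \<open>Bracketing $[s,as] = [s,a]s$ with $t$ shows $[s,a][t,s] \<in> S$. A factor $s' \<in> S$ can be
      inserted in the middle, and the Leibniz rule for $[s,as']$ then frees $a$ from its bracket.\<close>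
  have prod0: "comm s s' * comm t s = 0" if "s \<in> S" "s' \<in> S" "t \<in> S" for s s' t
  proof (rule no_left_ideal)
    fix a
    have 1: "comm s a * comm t s \<in> S" if "t \<in> S" for a t
    proof -
      have "comm s a * comm t s = comm t (comm s (a * s)) - comm t (comm s a) * s"
        by (simp add: comm_def algebra_simps)
      then show ?thesis using inv \<open>s \<in> S\<close> \<open>t \<in> S\<close> mult by simp
    qed
    have "comm s a * s' * comm t s = comm s a * comm (s' * t) s - comm s a * comm s' s * t"
      by (simp add: comm_def algebra_simps)
    then have "comm s a * s' * comm t s \<in> S" using 1 mult that by simp
    moreover have "a * (comm s s' * comm t s) = comm s (a * s') * comm t s - comm s a * s' * comm t s"
      by (simp add: comm_def algebra_simps)
    ultimately show "a * (comm s s' * comm t s) \<in> S" using 1 that by simp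
  qed
  have commute: "comm s t = 0" if st: "s \<in> S" "t \<in> S" for s t
  proof -
    \<comment> \<open>By \<open>prod0\<close> the sandwich $mSm$ vanishes. As $2mlm = -[m,[m,l]]$ for $m^2 = 0$, the
        elements $mlm$ with $l$ a commutator lie in $S$; with $l = [b,am]$ these are, up to sign, the
        elements $mambm$.\<close>
    define m where "m = comm s t"
    have m': "comm t s = - m" by (simp add: m_def comm_def)
    have mS: "m \<in> S" unfolding m_def comm_def using st mult by simp
    have mm: "m * m = 0" using prod0[of s t t] st by (simp add: m' flip: m_def)
    have mtm: "m * t' * m = 0" if "t' \<in> S" for t'
    proof -
      have "m * t' * comm t s = m * comm (t' * t) s - m * comm t' s * t"
        by (simp add: comm_def algebra_simps)
      then show ?thesis using prod0 st that mult by (simp add: m' m_def)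
    qed
    have mmx: "m * (m * x) = 0" for x using mm by (metis mult.assoc mult_zero_left)
    have mlm: "m * comm b c * m \<in> S" for b c
    proof -
      have "comm m (comm m (comm b c)) = - (2 *\<^sub>R (m * comm b c * m))"
        by (simp add: comm_def[of m] mm mmx algebra_simps scaleR_2)
      then have "m * comm b c * m = (- (1/2)) *\<^sub>R comm m (comm m (comm b c))" by simp
      moreover have "comm m (comm m (comm b c)) \<in> S"
        using mS inv[OF mS] mult by (simp add: comm_def[of m "comm m _"])
      ultimately show ?thesis by (metis subspace_scale[OF sub])
    qed
    have conv: "m * a * m * b * m = - (m * comm b (a * m) * m)" for a b
      by (simp add: comm_def mm mmx algebra_simps)
    have v: "m * a * m * b * m \<in> S" for a b
      unfolding conv using mlm by simp
    have "m * comm c d * m = 0" for c d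
    proof -
      let ?l = "comm c d"
      have "m * ?l * m * a * (m * b * (m * ?l * m)) = 0" for a b
      proof -
        let ?v = "m * a * m * b * m"
        have "comm (comm ?v ?l) ?l \<in> S" using inv v by blast
        then have "m * comm (comm ?v ?l) ?l * m = 0" by (rule mtm)
        moreover have "m * comm (comm ?v ?l) ?l * m =
            - (2 *\<^sub>R (m * ?l * m * a * (m * b * (m * ?l * m))))"
          by (simp add: comm_def[of "_ * _"] comm_def[of "comm _ _"] mm mmx algebra_simps scaleR_2)
             (simp add: comm_def mm mmx algebra_simps scaleR_2)
        ultimately show ?thesis by simp
      qed
      then have "m * ?l * m = 0 \<or> m * b * (m * ?l * m) = 0" for b
        by (rule primeness)
      then show ?thesis using primeness[of m "m * ?l * m"] by (metis mult_zero_left)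
    qed
    then have "m * a * (m * b * m) = 0" for a b
      using conv[of a b] by (simp add: mult.assoc)
    then have "m = 0 \<or> m * b * m = 0" for b by (rule primeness)
    then have "m = 0" using primeness[of m m] by auto
    then show ?thesis by (simp add: m_def)
  qed
  have "comm s (comm s (comm a b)) = 0" for a b
    using commute inv \<open>s \<in> S\<close> by blast
  then show ?thesis by (rule central_if_double_comm_kills_commutators)
qed auto

end

section \<open>Commutators as combinations of square-zero elements\<close>

definition transporter :: "'a::ring set \<Rightarrow> 'a set" where
  "transporter U = {s. \<forall>a. comm s a \<in> U}"

lemma subspace_transporter:
  fixes U :: "'a::real_algebra_1 set"
  assumes "subspace U" shows "subspace (transporter U)"
proof (rule subspaceI)
  show "0 \<in> transporter U" using assms by (simp add: transporter_def comm_def subspace_0)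
next
  fix x y assume "x \<in> transporter U" "y \<in> transporter U"
  moreover have "comm (x + y) a = comm x a + comm y a" for a by (simp add: comm_def algebra_simps)
  ultimately show "x + y \<in> transporter U" using assms by (simp add: transporter_def subspace_add)
next
  fix c x assume "x \<in> transporter U"
  moreover have "comm (c *\<^sub>R x) a = c *\<^sub>R comm x a" for a by (simp add: comm_def algebra_simps)
  ultimately show "c *\<^sub>R x \<in> transporter U" using assms by (simp add: transporter_def subspace_scale)
qed

lemma transporter_mult:
  fixes U :: "'a::real_algebra_1 set"
  assumes "subspace U" "s \<in> transporter U" "t \<in> transporter U"
  shows "s * t \<in> transporter U"
proof -
  have "comm (s * t) a = comm s (t * a) + comm t (a * s)" for a
    by (simp add: comm_def algebra_simps)
  then show ?thesis using assms by (simp add: transporter_def subspace_add)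
qed

lemma comm_of_span_square_zero:
  fixes U :: "'a::real_algebra_1 set"
  assumes U: "subspace U" and inv: "\<And>u x. u \<in> U \<Longrightarrow> x * x = 0 \<Longrightarrow> comm u x \<in> U"
    and "u \<in> U" and "t \<in> span {x. x * x = 0}"
  shows "comm u t \<in> U"
  using \<open>t \<in> _\<close>
proof (induction rule: span_induct_alt)
  case base
  then show ?case using U by (simp add: comm_def subspace_0)
next
  case (step c x y)
  have "comm u (c *\<^sub>R x + y) = c *\<^sub>R comm u x + comm u y"
    by (simp add: comm_def algebra_simps)
  then show ?case using step inv[OF \<open>u \<in> U\<close>] U by (simp add: subspace_add subspace_scale)
qed

text \<open>
  Conjugates of square-zero elements have square zero, and $[x,y]$ is half the difference of the
  conjugates of $y$ by $1 + x$ and by $1 - x$, which is the inverse of $1 + x$.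
\<close>

lemma comm_square_zero_in_span:
  fixes x y :: "'a::real_algebra_1"
  assumes x: "x * x = 0" and y: "y * y = 0"
  shows "comm x y \<in> span {x. x * x = 0}"
proof -
  have xx: "x * (x * z) = 0" for z using x by (metis mult.assoc mult_zero_left)
  have yy: "y * (y * z) = 0" for z using y by (metis mult.assoc mult_zero_left)
  have 1: "((1 + x) * y * (1 - x)) * ((1 + x) * y * (1 - x)) = 0"
    by (simp add: x y xx yy algebra_simps)
  have 2: "((1 - x) * y * (1 + x)) * ((1 - x) * y * (1 + x)) = 0"
    by (simp add: x y xx yy algebra_simps)
  have "(1/2) *\<^sub>R ((1 + x) * y * (1 - x) - (1 - x) * y * (1 + x)) \<in> span {x. x * x = 0}"
    by (intro span_scale span_diff span_base) (use 1 2 in auto)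
  moreover have "(1 + x) * y * (1 - x) - (1 - x) * y * (1 + x) = 2 *\<^sub>R comm x y"
    by (simp add: comm_def algebra_simps scaleR_2)
  ultimately show ?thesis by simp
qed

text \<open>
  The elements $p'$ and $q'$ are orthogonal local units of $p$ and $q$. For $x = paq$ they split
  $[x,b] = xb(1-p') - (1-q')bx + [x, q'bp']$. The first two terms have square zero because
  $(1-p')p = 0 = q(1-q')$, and the third is a commutator of square-zero elements.
\<close>

lemma corner_in_transporter:
  fixes p q :: "'a::real_algebra_1"
  assumes p: "p' * p = p" "p * p' = p" and q: "q' * q = q" "q * q' = q"
    and orth: "p' * q' = 0" "q' * p' = 0"
  shows "p * a * q \<in> transporter (span {x. x * x = 0})"
proof -
  let ?T = "span {x::'a. x * x = 0}"
  let ?x = "p * a * q"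
  have "q * p = (q * q') * (p' * p)" using p q by simp
  also have "\<dots> = q * (q' * p') * p" by (simp only: mult.assoc)
  finally have qp: "q * p = 0" using orth by simp
  have sq: "(s * c * t) * (s * c * t) = 0" if "t * s = 0" for s c t :: 'a
  proof -
    have "(s * c * t) * (s * c * t) = s * c * (t * s) * c * t" by (simp only: mult.assoc)
    then show ?thesis using that by simp
  qed
  have "comm ?x b \<in> ?T" for b :: 'a
  proof -
    have 1: "p * (a * q * b) * (1 - p') \<in> ?T"
      by (intro span_base CollectI sq) (simp add: p algebra_simps)
    have 2: "(1 - q') * (b * p * a) * q \<in> ?T"
      by (intro span_base CollectI sq) (simp add: q algebra_simps)
    have 3: "comm ?x (q' * b * p') \<in> ?T"
      by (intro comm_square_zero_in_span sq) (use qp orth in auto)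
    have "comm ?x b = p * (a * q * b) * (1 - p') - (1 - q') * (b * p * a) * q
        + (p * a * q * b * p' - q' * b * p * a * q)"
      by (simp add: comm_def algebra_simps)
    also have "p * a * q * b * p' - q' * b * p * a * q =
        p * a * (q * q') * b * p' - q' * b * (p' * p) * a * q"
      by (simp only: p q)
    also have "p * a * (q * q') * b * p' - q' * b * (p' * p) * a * q = comm ?x (q' * b * p')"
      by (simp add: comm_def algebra_simps)
    finally have 4: "comm ?x b = p * (a * q * b) * (1 - p') - (1 - q') * (b * p * a) * q
        + comm ?x (q' * b * p')" .
    show ?thesis unfolding 4 by (intro span_add span_diff 1 2 3)
  qed
  then show ?thesis by (simp add: transporter_def)
qed

context simple_algebra
begin

text \<open>
  Let $S$ be the transporter of $T$. Along the chain, $e_{i+1}$ and $1 - e_{j-1}$ are orthogonal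
  local units of $e_i$ and $1 - e_j$ as soon as $i + 3 \<le> j$, so $e_iA(1-e_j)$ lies in $S$. For
  $i \<le> 1$ the missing part $e_iAe_4$ of $e_iA$ is recovered from
  $e_iA(1-e_8) \<cdot> (1-e_7)Ae_4$. Hence $e_iA$ and $Ae_i$ lie in $S$, and so does the ideal
  $Ae_1e_0A = Ae_0A$. The length of the chain is what these gaps require.
\<close>

lemma commutators_in_span_square_zero:
  fixes e :: "nat \<Rightarrow> 'a"
  assumes e: "\<And>i j. i < j \<Longrightarrow> j \<le> 8 \<Longrightarrow> e i * e j = e i \<and> e j * e i = e i"
    and "e 0 \<noteq> 0" and "e 8 \<noteq> 1"
  shows "comm a b \<in> span {x::'a. x * x = 0}"
proof -
  define S where "S = transporter (span {x::'a. x * x = 0})"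
  have sub: "subspace S" unfolding S_def by (intro subspace_transporter subspace_span)
  have mult: "s * t \<in> S" if "s \<in> S" "t \<in> S" for s t
    using that unfolding S_def by (intro transporter_mult subspace_span)
  have corner: "e i * a * (1 - e j) \<in> S" "(1 - e j) * a * e i \<in> S" if "i + 3 \<le> j" "j \<le> 8" for i j a
  proof -
    define e' f f' where "e' = e (i + 1)" and "f = e j" and "f' = e (j - 1)"
    have e': "e i * e' = e i" "e' * e i = e i"
      using e[of i "i + 1"] that by (simp_all add: e'_def)
    have f': "f' * f = f'" "f * f' = f'"
      using e[of "j - 1" j] that by (simp_all add: f_def f'_def)
    have e'f': "e' * f' = e'" "f' * e' = e'"
      using e[of "i + 1" "j - 1"] that by (simp_all add: e'_def f'_def)
    note simps = e' f' e'f' left_diff_distrib right_diff_distrib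
    have "e i * a * (1 - f) \<in> S"
      unfolding S_def
      by (rule corner_in_transporter[where p' = e' and q' = "1 - f'"]) (simp_all add: simps)
    then show "e i * a * (1 - e j) \<in> S" by (simp add: f_def)
    have "(1 - f) * a * e i \<in> S"
      unfolding S_def
      by (rule corner_in_transporter[where p' = "1 - f'" and q' = e']) (simp_all add: simps)
    then show "(1 - e j) * a * e i \<in> S" by (simp add: f_def)
  qed
  have prod: "(1 - e 8) * (1 - e 7) = 1 - e 8" "(1 - e 7) * (1 - e 8) = 1 - e 8"
    using e[of 7 8] by (simp_all add: algebra_simps)
  have left: "e i * a \<in> S" if "i \<le> 1" for i a
  proof -
    have "e i * c * e 4 \<in> S" for c
    proof (rule fill_middle[OF sub])
      show "1 - e 8 \<noteq> 0" using \<open>e 8 \<noteq> 1\<close> by simp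
      fix a b
      have "(e i * a * (1 - e 8)) * ((1 - e 7) * b * e 4) \<in> S"
        using that by (intro mult corner) simp_all
      moreover have "(e i * a * (1 - e 8)) * ((1 - e 7) * b * e 4) =
          e i * a * ((1 - e 8) * (1 - e 7)) * b * e 4"
        by (simp only: mult.assoc)
      ultimately show "e i * a * (1 - e 8) * b * e 4 \<in> S" using prod by simp
    qed
    then have "e i * a * e 4 + e i * a * (1 - e 4) \<in> S"
      using that by (intro subspace_add[OF sub] corner) simp_all
    then show ?thesis by (simp add: algebra_simps)
  qed
  have right: "a * e i \<in> S" if "i \<le> 1" for i a
  proof -
    have "e 4 * c * e i \<in> S" for c
    proof (rule fill_middle[OF sub])
      show "1 - e 8 \<noteq> 0" using \<open>e 8 \<noteq> 1\<close> by simp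
      fix a b
      have "(e 4 * a * (1 - e 7)) * ((1 - e 8) * b * e i) \<in> S"
        using that by (intro mult corner) simp_all
      moreover have "(e 4 * a * (1 - e 7)) * ((1 - e 8) * b * e i) =
          e 4 * a * ((1 - e 7) * (1 - e 8)) * b * e i"
        by (simp only: mult.assoc)
      ultimately show "e 4 * a * (1 - e 8) * b * e i \<in> S" using prod by simp
    qed
    then have "e 4 * a * e i + (1 - e 4) * a * e i \<in> S"
      using that by (intro subspace_add[OF sub] corner) simp_all
    then show ?thesis by (simp add: algebra_simps)
  qed
  have "1 * a * 1 \<in> S"
  proof (rule fill_middle[OF sub \<open>e 0 \<noteq> 0\<close>])
    fix a b
    have "(a * e 1) * (e 0 * b) \<in> S" by (intro mult left right) simp_all
    moreover have "(a * e 1) * (e 0 * b) = a * (e 1 * e 0) * b" by (simp add: mult.assoc)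
    ultimately show "1 * a * e 0 * b * 1 \<in> S" using e[of 0 1] by simp
  qed
  then show ?thesis by (simp add: S_def transporter_def)
qed

section \<open>Subspaces invariant under square-zero elements\<close>

text \<open>
  For $x^2 = 0$ the element $c = [u,[u,x]]$ is central. Put $d = [u,x]$ and apply $[u,\<cdot>]$
  repeatedly to $x^2 = 0$: this gives $cx + d^2 = 0$ and then $3cd = 0$. A nonzero central element of a simple
  algebra is not a zero divisor, so $c = 0$. Thus $[u,[u,\<cdot>]]$ kills the span of the square-zero
  elements, hence all commutators.
\<close>

lemma central_if_commutators_central:
  fixes U :: "'a set"
  assumes inv: "\<And>u x. u \<in> U \<Longrightarrow> x * x = 0 \<Longrightarrow> comm u x \<in> U"
    and L: "\<And>a b. comm a b \<in> span {x::'a. x * x = 0}"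
    and central: "\<And>u v a. u \<in> U \<Longrightarrow> v \<in> U \<Longrightarrow> comm (comm u v) a = 0"
    and u: "u \<in> U"
  shows "comm u a = 0"
proof -
  have kill: "comm u (comm u x) = 0" if x: "x * x = 0" for x
  proof -
    define d c where "d = comm u x" and "c = comm u d"
    have cc: "c * y = y * c" for y
      using central[OF u inv[OF u x], of y] by (simp add: c_def d_def comm_def)
    have "comm u (x * x) = 0" using x by (simp add: comm_def)
    then have 1: "d * x + x * d = 0" by (simp add: d_def comm_def algebra_simps)
    have "comm u (d * x + x * d) = c * x + 2 *\<^sub>R (d * d) + x * c"
      by (simp add: c_def d_def comm_def algebra_simps scaleR_2)
    then have "2 *\<^sub>R (c * x + d * d) = 0"
      unfolding 1 by (simp add: cc[of x, symmetric] comm_def scaleR_2 algebra_simps)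
    then have 2: "c * x + d * d = 0" by simp
    have "comm u c = 0" using cc[of u] by (simp add: comm_def)
    moreover have "comm u (c * x + d * d) = comm u c * x + c * d + (c * d + d * c)"
      by (simp add: c_def d_def comm_def algebra_simps)
    ultimately have "c * d + (c * d + c * d) = 0" unfolding 2 by (simp add: comm_def flip: cc[of d])
    moreover have "c * d + (c * d + c * d) = 3 *\<^sub>R (c * d)"
      using scaleR_left_distrib[of 2 1 "c * d"] by (simp add: scaleR_2)
    ultimately have "c * d = 0" by simp
    then have "c * y * d = 0" for y by (metis cc mult.assoc mult_zero_right)
    then have "c = 0 \<or> d = 0" by (rule primeness)
    then show ?thesis by (auto simp: c_def d_def comm_def)
  qed
  have DD: "comm u (comm u t) = 0" if "t \<in> span {x::'a. x * x = 0}" for t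
    using that
  proof (induction rule: span_induct_alt)
    case (step k x y)
    have "comm u (comm u (k *\<^sub>R x + y)) = k *\<^sub>R comm u (comm u x) + comm u (comm u y)"
      by (simp add: comm_def algebra_simps)
    then show ?case using step kill by simp
  qed (simp add: comm_def)
  show ?thesis by (rule central_if_double_comm_kills_commutators) (rule DD[OF L])
qed

text \<open>
  The transporter of $U$ contains $[U,U]$ because $[[u,v],a] = [u,[v,a]] - [v,[u,a]]$ and because
  $U$ is invariant under commutators; the invariance also passes to the transporter itself.
\<close>

lemma central_or_contains_commutators:
  fixes U :: "'a set"
  assumes sub: "subspace U"
    and inv: "\<And>u x. u \<in> U \<Longrightarrow> x * x = 0 \<Longrightarrow> comm u x \<in> U"
    and L: "\<And>a b. comm a b \<in> span {x::'a. x * x = 0}"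
  shows "(\<forall>u\<in>U. \<forall>a. comm u a = 0) \<or> (\<forall>a b. comm a b \<in> U)"
proof (rule disjCI)
  assume not_all: "\<not> (\<forall>a b. comm a b \<in> U)"
  have UL: "comm u (comm a b) \<in> U" if "u \<in> U" for u a b
    using comm_of_span_square_zero[OF sub inv that L] .
  let ?S = "transporter U"
  have "?S \<noteq> UNIV" using not_all by (auto simp: transporter_def)
  moreover have "comm s (comm a b) \<in> ?S" if "s \<in> ?S" for s a b
  proof -
    have "comm (comm s (comm a b)) c = comm s (comm (comm a b) c) + comm (comm s c) (comm a b)" for c
      by (simp add: comm_def algebra_simps)
    then show ?thesis using that UL sub by (simp add: transporter_def subspace_add)
  qed
  ultimately have S_central: "comm s a = 0" if "s \<in> ?S" for s a
    by (intro proper_invariant_subalgebra_central[OF subspace_transporter[OF sub] _ _ _ that]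
        transporter_mult[OF sub])
  have "comm u v \<in> ?S" if "u \<in> U" "v \<in> U" for u v
  proof -
    have "comm (comm u v) a = comm u (comm v a) - comm v (comm u a)" for a
      by (simp add: comm_def algebra_simps)
    then show ?thesis using that UL sub by (simp add: transporter_def subspace_diff)
  qed
  then have "comm (comm u v) a = 0" if "u \<in> U" "v \<in> U" for u v a
    using S_central that by simp
  then have "comm u a = 0" if "u \<in> U" for u a
    using central_if_commutators_central[of U, OF inv L _ that] by simp
  then show "\<forall>u\<in>U. \<forall>a. comm u a = 0" by simp
qed

end

section \<open>The square root series in a Banach algebra\<close>

text \<open>The Taylor coefficients of $\<surd>(1-x)$ at $0$.\<close>

definition sqrt_coeff :: "nat \<Rightarrow> real" where
  "sqrt_coeff n = (-1) ^ n * (1/2 gchoose n)"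

definition sqrt_one_minus :: "'a::{real_normed_algebra_1,banach} \<Rightarrow> 'a" where
  "sqrt_one_minus x = (\<Sum>n. sqrt_coeff n *\<^sub>R x ^ n)"

lemma sqrt_coeff_0: "sqrt_coeff 0 = 1"
  by (simp add: sqrt_coeff_def)

lemma sqrt_coeff_Suc_nonpos: "sqrt_coeff (Suc n) \<le> 0"
proof (induction n)
  case (Suc n)
  have "sqrt_coeff (Suc (Suc n)) = sqrt_coeff (Suc n) * ((real (Suc n) - 1/2) / real (Suc (Suc n)))"
    by (simp add: sqrt_coeff_def gbinomial_prod_rev divide_simps)
       (simp add: algebra_simps)
  moreover have "(real (Suc n) - 1/2) / real (Suc (Suc n)) \<ge> 0" by simp
  ultimately show ?case using Suc by (metis mult_nonpos_nonneg)
qed (simp add: sqrt_coeff_def)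

text \<open>
  All coefficients but the first are nonpositive, so the claim says that the partial sums of the series at
  $x = 1$ are nonnegative; these have the closed form $(-1)^n \<cdot> {-1/2 \choose n}$. This makes the series
  converge absolutely on the closed unit ball, not only inside it.
\<close>

lemma sqrt_coeff_partial_sum: "(\<Sum>k<n. \<bar>sqrt_coeff (Suc k)\<bar>) \<le> 1"
proof -
  have "(\<Sum>k\<le>n. sqrt_coeff k) = (-1) ^ n * (- (1/2) gchoose n)"
    using gbinomial_sum_lower_neg[of "1/2 :: real" n]
    by (simp add: sqrt_coeff_def mult.commute)
  also have "\<dots> = pochhammer (1/2) n / fact n"
    by (simp add: gbinomial_pochhammer)
  also have "\<dots> \<ge> 0" by (simp add: pochhammer_nonneg)
  finally have "0 \<le> (\<Sum>k\<le>n. sqrt_coeff k)" .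
  also have "(\<Sum>k\<le>n. sqrt_coeff k) = 1 - (\<Sum>k<n. \<bar>sqrt_coeff (Suc k)\<bar>)"
    by (simp add: sum.atMost_shift sqrt_coeff_0 abs_of_nonpos[OF sqrt_coeff_Suc_nonpos] sum_negf)
  finally show ?thesis by simp
qed

lemma summable_sqrt_coeff_Suc: "summable (\<lambda>n. \<bar>sqrt_coeff (Suc n)\<bar>)"
  using sqrt_coeff_partial_sum by (intro summableI_nonneg_bounded[where x = 1]) auto

lemma summable_sqrt_coeff: "summable (\<lambda>n. \<bar>sqrt_coeff n\<bar>)"
  using summable_sqrt_coeff_Suc by (subst (asm) summable_Suc_iff)

lemma norm_power_le_1: "norm x \<le> 1 \<Longrightarrow> norm (x ^ n) \<le> 1"
  for x :: "'a::real_normed_algebra_1"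
  using norm_power_ineq[of x n] power_le_one[of "norm x" n] by simp

lemma norm_sqrt_term_le:
  fixes x :: "'a::real_normed_algebra_1"
  assumes "norm x \<le> 1" shows "norm (sqrt_coeff n *\<^sub>R x ^ n) \<le> \<bar>sqrt_coeff n\<bar>"
  using norm_power_le_1[OF assms, of n] by (simp add: mult_left_le)

lemma summable_norm_sqrt_series:
  fixes x :: "'a::{real_normed_algebra_1,banach}"
  assumes "norm x \<le> 1" shows "summable (\<lambda>n. norm (sqrt_coeff n *\<^sub>R x ^ n))"
  by (rule summable_comparison_test'[OF summable_sqrt_coeff, of 0])
     (use norm_sqrt_term_le[OF assms] in simp)

lemma summable_sqrt_series:
  fixes x :: "'a::{real_normed_algebra_1,banach}"
  assumes "norm x \<le> 1" shows "summable (\<lambda>n. sqrt_coeff n *\<^sub>R x ^ n)"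
  using summable_norm_sqrt_series[OF assms] by (rule summable_norm_cancel)

lemma norm_one_minus_sqrt_le:
  fixes x :: "'a::{real_normed_algebra_1,banach}"
  assumes "norm x \<le> 1" shows "norm (1 - sqrt_one_minus x) \<le> 1"
proof -
  let ?f = "\<lambda>n. sqrt_coeff (Suc n) *\<^sub>R x ^ Suc n"
  have "sqrt_one_minus x - 1 = (\<Sum>n. ?f n)"
    using suminf_split_head[OF summable_sqrt_series[OF assms]]
    by (simp add: sqrt_one_minus_def sqrt_coeff_0)
  moreover have "norm (\<Sum>n. ?f n) \<le> (\<Sum>n. norm (?f n))"
    using summable_norm_sqrt_series[OF assms] by (intro summable_norm) (subst summable_Suc_iff)
  moreover have "(\<Sum>n. norm (?f n)) \<le> (\<Sum>n. \<bar>sqrt_coeff (Suc n)\<bar>)"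
    by (rule suminf_le[OF norm_sqrt_term_le[OF assms] _ summable_sqrt_coeff_Suc])
       (use summable_norm_sqrt_series[OF assms] in \<open>subst summable_Suc_iff\<close>)
  moreover have "(\<Sum>n. \<bar>sqrt_coeff (Suc n)\<bar>) \<le> 1"
    by (rule suminf_le_const[OF summable_sqrt_coeff_Suc sqrt_coeff_partial_sum])
  ultimately show ?thesis by (metis norm_minus_commute order_trans)
qed

text \<open>
  In the Cauchy product, Vandermonde's identity turns the coefficients into those of the
  binomial series with exponent $1/2 + 1/2 = 1$.
\<close>

lemma sqrt_one_minus_square:
  fixes x :: "'a::{real_normed_algebra_1,banach}"
  assumes "norm x \<le> 1" shows "sqrt_one_minus x * sqrt_one_minus x = 1 - x"
proof -
  have conv: "(\<Sum>i\<le>k. sqrt_coeff i *\<^sub>R x ^ i * sqrt_coeff (k - i) *\<^sub>R x ^ (k - i))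
      = ((-1) ^ k * (1 gchoose k)) *\<^sub>R x ^ k" for k
  proof -
    have "sqrt_coeff i *\<^sub>R x ^ i * sqrt_coeff (k - i) *\<^sub>R x ^ (k - i) =
        ((-1) ^ k * ((1/2 gchoose i) * (1/2 gchoose (k - i)))) *\<^sub>R x ^ k" if "i \<le> k" for i
    proof -
      have "x ^ i * x ^ (k - i) = x ^ k" "(-1::real) ^ i * (-1) ^ (k - i) = (-1) ^ k"
        using that by (simp_all flip: power_add)
      then show ?thesis by (simp add: sqrt_coeff_def ac_simps)
    qed
    then have "(\<Sum>i\<le>k. sqrt_coeff i *\<^sub>R x ^ i * sqrt_coeff (k - i) *\<^sub>R x ^ (k - i)) =
        ((-1) ^ k * (\<Sum>i\<le>k. (1/2 gchoose i) * (1/2 gchoose (k - i)))) *\<^sub>R x ^ k"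
      by (simp add: sum_distrib_left scaleR_sum_left)
    also have "(\<Sum>i\<le>k. (1/2 gchoose i) * (1/2 gchoose (k - i))) = ((1::real) gchoose k)"
      using gbinomial_Vandermonde[of "1/2 :: real" "1/2" k] by (simp add: atMost_atLeast0)
    finally show ?thesis .
  qed
  have "sqrt_one_minus x * sqrt_one_minus x = (\<Sum>k. ((-1) ^ k * (1 gchoose k)) *\<^sub>R x ^ k)"
    unfolding sqrt_one_minus_def
    unfolding Cauchy_product[OF summable_norm_sqrt_series summable_norm_sqrt_series, OF assms assms]
    by (simp only: conv)
  also have "\<dots> = (\<Sum>k\<in>{0,1}. ((-1) ^ k * (1 gchoose k)) *\<^sub>R x ^ k)"
  proof (rule suminf_finite)
    fix n :: nat assume "n \<notin> {0,1}"
    then have "(of_nat 1 :: real) gchoose n = 0"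
      by (subst binomial_gbinomial[symmetric]) simp
    then show "((-1) ^ n * (1 gchoose n)) *\<^sub>R x ^ n = 0" by simp
  qed simp
  finally show ?thesis by simp
qed

lemma sqrt_one_minus_commute:
  fixes x y :: "'a::{real_normed_algebra_1,banach}"
  assumes "norm x \<le> 1" and "x * y = y * x"
  shows "sqrt_one_minus x * y = y * sqrt_one_minus x"
proof -
  have "x ^ n * y = y * x ^ n" for n
    using assms(2) by (rule power_commuting_commutes)
  then have "(\<Sum>n. (sqrt_coeff n *\<^sub>R x ^ n) * y) = (\<Sum>n. y * (sqrt_coeff n *\<^sub>R x ^ n))"
    by simp
  then show ?thesis unfolding sqrt_one_minus_def
    by (simp only: suminf_mult suminf_mult2 summable_sqrt_series[OF assms(1)])
qed

lemma continuous_on_sqrt_one_minus: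
  "continuous_on (cball 0 1) (sqrt_one_minus :: 'a::{real_normed_algebra_1,banach} \<Rightarrow> 'a)"
  unfolding sqrt_one_minus_def
proof (rule uniform_limit_theorem[OF _ Weierstrass_m_test[OF _ summable_sqrt_coeff]])
  show "\<forall>\<^sub>F n in sequentially. continuous_on (cball 0 1) (\<lambda>x::'a. \<Sum>i<n. sqrt_coeff i *\<^sub>R x ^ i)"
    by (intro always_eventually allI continuous_intros)
  show "norm (sqrt_coeff n *\<^sub>R x ^ n) \<le> \<bar>sqrt_coeff n\<bar>" if "x \<in> cball 0 1" for n and x :: 'a
    using that by (intro norm_sqrt_term_le) simp
qed simp

section \<open>Absolute values of self-adjoint contractions\<close>

lemma star_0: "star 0 = 0"
  using star_add[of 0 0] by simp

lemma star_scaleR: "star (r *\<^sub>R x) = r *\<^sub>R star x"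
  using star_scaleC[of "complex_of_real r" x] by (simp add: scaleC_of_real)

lemma star_1: "star 1 = 1"
  by (metis mult.right_neutral mult_1 star_mult star_star)

lemma star_minus: "star (- x) = - star x"
  using star_scaleR[of "-1" x] by simp

lemma star_diff: "star (x - y) = star x - star y"
  using star_add[of x "- y"] by (simp add: star_minus)

lemma star_power: "star (x ^ n) = star x ^ n"
  by (induction n) (simp_all add: star_1 star_mult power_commutes)

lemma norm_star: "norm (star x) = norm x"
proof -
  have le: "norm y \<le> norm (star y)" for y :: 'a
  proof (cases "y = 0")
    case False
    have "norm y * norm y \<le> norm (star y) * norm y"
      using cstar_identity[of y] norm_mult_ineq[of "star y" y] by (simp add: power2_eq_square)
    then show ?thesis using False by simp
  qed (simp add: star_0)
  show ?thesis using le[of x] le[of "star x"] by (simp add: star_star)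
qed

lemma bounded_linear_star: "bounded_linear (star :: 'a::unital_cstar_algebra \<Rightarrow> 'a)"
  by (rule bounded_linear_intro[where K = 1]) (simp_all add: star_add star_scaleR norm_star)

lemma star_sqrt_one_minus:
  fixes x :: "'a::unital_cstar_algebra"
  assumes "norm x \<le> 1" "star x = x"
  shows "star (sqrt_one_minus x) = sqrt_one_minus x"
  unfolding sqrt_one_minus_def
  using bounded_linear.suminf[OF bounded_linear_star summable_sqrt_series[OF assms(1)]]
  by (simp add: star_scaleR star_power assms(2))

text \<open>
  With $s = \<surd>(1 - h^2)$, the element $u = h + is$ is unitary, so $\<parallel>u\<parallel> = 1$ and
  $\<parallel>s\<parallel> = \<parallel>u - u^*\<parallel> / 2 \<le> 1$. Finally $1 - h^2 = s^2$.
\<close>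

lemma norm_one_minus_square_le:
  fixes h :: "'a::unital_cstar_algebra"
  assumes h: "star h = h" and "norm h \<le> 1"
  shows "norm (1 - h * h) \<le> 1"
proof -
  define s where "s = sqrt_one_minus (h * h)"
  have hh: "norm (h * h) \<le> 1"
    using norm_mult_ineq[of h h] mult_le_one[OF \<open>norm h \<le> 1\<close> _ \<open>norm h \<le> 1\<close>] by simp
  have s: "star s = s" unfolding s_def using hh h by (intro star_sqrt_one_minus) (simp_all add: star_mult)
  have ss: "s * s = 1 - h * h" unfolding s_def using hh by (rule sqrt_one_minus_square)
  have sh: "s * h = h * s" unfolding s_def using hh by (intro sqrt_one_minus_commute) (simp_all add: mult.assoc)
  define u where "u = h + \<i> *\<^sub>C s"
  have star_u: "star u = h - \<i> *\<^sub>C s"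
    by (simp add: u_def star_add star_scaleC h s complex_vector.scale_minus_left)
  have "star u * u = h * h + s * s"
    unfolding star_u unfolding u_def
    by (simp add: algebra_simps mult_scaleC_left mult_scaleC_right scaleC_scaleC sh
        complex_vector.scale_minus_left)
  then have "star u * u = 1" by (simp add: ss)
  then have "norm u = 1" using cstar_identity[of u] by (simp add: power2_eq_1_iff)
      (metis norm_ge_zero neg_0_le_iff_le not_one_le_zero order.trans)
  moreover have "u - star u = (2 * \<i>) *\<^sub>C s"
    unfolding star_u unfolding u_def
    by (simp flip: scaleC_add_left)
  then have "norm (u - star u) = 2 * norm s" by (simp add: norm_scaleC norm_mult)
  ultimately have "norm s \<le> 1" using norm_triangle_ineq4[of u "star u"] by (simp add: norm_star)
  then show ?thesis using norm_mult_ineq[of s s] mult_le_one[of "norm s" "norm s"] by (simp flip: ss)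
qed

text \<open>The absolute value, for self-adjoint contractions.\<close>

definition cabs :: "'a::unital_cstar_algebra \<Rightarrow> 'a" where
  "cabs h = sqrt_one_minus (1 - h * h)"

definition contraction_sa :: "'a::unital_cstar_algebra \<Rightarrow> bool" where
  "contraction_sa h \<longleftrightarrow> star h = h \<and> norm h \<le> 1"

lemma cabs_square: "contraction_sa h \<Longrightarrow> cabs h * cabs h = h * h"
  unfolding cabs_def contraction_sa_def
  by (simp add: sqrt_one_minus_square norm_one_minus_square_le)

lemma norm_one_minus_cabs_le: "contraction_sa h \<Longrightarrow> norm (1 - cabs h) \<le> 1"
  unfolding cabs_def contraction_sa_def
  by (simp add: norm_one_minus_sqrt_le norm_one_minus_square_le)

lemma cabs_commute:
  assumes "contraction_sa h" "h * y = y * h"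
  shows "cabs h * y = y * cabs h"
proof -
  have "h * h * y = y * (h * h)" using assms(2) by (metis mult.assoc)
  then show ?thesis
    using assms(1) unfolding cabs_def contraction_sa_def
    by (intro sqrt_one_minus_commute norm_one_minus_square_le) (simp_all add: algebra_simps)
qed

definition pos_part :: "'a::unital_cstar_algebra \<Rightarrow> 'a" where
  "pos_part h = (1/2) *\<^sub>R (cabs h + h)"

definition neg_part :: "'a::unital_cstar_algebra \<Rightarrow> 'a" where
  "neg_part h = (1/2) *\<^sub>R (cabs h - h)"

lemma pos_minus_neg: "pos_part h - neg_part h = h"
  by (simp add: pos_part_def neg_part_def flip: scaleR_diff_right scaleR_2)

lemma pos_neg_commute:
  assumes a: "contraction_sa a" and b: "contraction_sa b" and ab: "a * b = b * a"
  shows "pos_part a * neg_part b = neg_part b * pos_part a"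
proof -
  have 1: "cabs a * b = b * cabs a" using a ab by (rule cabs_commute)
  have 2: "cabs b * a = a * cabs b" using b ab[symmetric] by (rule cabs_commute)
  have 3: "cabs a * cabs b = cabs b * cabs a" using a 2[symmetric] by (rule cabs_commute)
  show ?thesis
    by (simp add: pos_part_def neg_part_def ab 1 2 3 algebra_simps)
qed

text \<open>
  Let $w$ be the product. On it, $|a|$ acts as $a$ and $|b|$ acts as $-b$, so $|a| + |b|$ acts as
  $a - b = -r$ and $(1 - |a|) + (1 - |b|)$ acts as $2 + r$. But both summands have norm at most $1$, so
  $w = 0$ when $r > 0$. For $r = 0$ the claim is $|a|^2 = a^2$.
\<close>

lemma pos_neg_orthogonal:
  assumes a: "contraction_sa a" and b: "contraction_sa b" and ba: "b = a + r *\<^sub>R 1" and "r \<ge> 0"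
  shows "pos_part a * neg_part b = 0"
proof (cases "r = 0")
  case True
  then show ?thesis
    using cabs_square[OF a] cabs_commute[OF a refl]
    by (simp add: ba pos_part_def neg_part_def algebra_simps)
next
  case False
  have ab: "a * b = b * a" by (simp add: ba algebra_simps)
  define w where "w = pos_part a * neg_part b"
  have "cabs a * pos_part a = a * pos_part a"
    using cabs_square[OF a] cabs_commute[OF a refl] by (simp add: pos_part_def algebra_simps)
  then have 1: "cabs a * w = a * w" by (simp add: w_def flip: mult.assoc)
  have "cabs b * neg_part b = - b * neg_part b"
    using cabs_square[OF b] cabs_commute[OF b refl] by (simp add: neg_part_def algebra_simps)
  then have 2: "cabs b * w = - b * w"
    unfolding w_def pos_neg_commute[OF a b ab] by (simp flip: mult.assoc)
  have "b * w = a * w + r *\<^sub>R w" by (simp add: ba distrib_right)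
  then have "(2 + r) *\<^sub>R w = (1 - cabs a) * w + (1 - cabs b) * w"
    by (simp add: left_diff_distrib 1 2 scaleR_left_distrib scaleR_2)
  then have "(2 + r) * norm w = norm ((1 - cabs a) * w + (1 - cabs b) * w)"
    using \<open>r \<ge> 0\<close> by (metis abs_of_nonneg add_nonneg_nonneg norm_scaleR zero_le_numeral)
  also have "\<dots> \<le> norm ((1 - cabs a) * w) + norm ((1 - cabs b) * w)" by (rule norm_triangle_ineq)
  also have "\<dots> \<le> 1 * norm w + 1 * norm w"
    by (intro add_mono norm_mult_ineq[THEN order_trans] mult_right_mono
        norm_one_minus_cabs_le a b norm_ge_zero)
  finally have "r * norm w \<le> 0" by (simp add: algebra_simps)
  then have "w = 0" using \<open>r \<ge> 0\<close> False by (simp add: mult_le_0_iff)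
  then show ?thesis by (simp add: w_def)
qed

section \<open>Chains of local units\<close>

text \<open>
  The bound $1/4$ keeps $h - s$ a contraction for all thresholds $|s| \<le> 3/4$, while
  $h + 1/2$ and $h - 1/2$ already have a definite sign.
\<close>

context
  fixes h :: "'a::unital_cstar_algebra"
  assumes h_sa: "star h = h" and norm_h: "norm h \<le> 1/4"
begin

abbreviation (input) P :: "real \<Rightarrow> 'a" where "P s \<equiv> pos_part (h - s *\<^sub>R 1)"
abbreviation (input) N :: "real \<Rightarrow> 'a" where "N s \<equiv> neg_part (h - s *\<^sub>R 1)"

lemma contraction_shift: "\<bar>s\<bar> \<le> 3/4 \<Longrightarrow> contraction_sa (h - s *\<^sub>R 1)"
  using norm_triangle_ineq4[of h "s *\<^sub>R 1"] norm_h
  by (simp add: contraction_sa_def star_diff star_scaleR star_1 h_sa)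

lemma pos_neg_shift:
  assumes "t \<le> s" "\<bar>s\<bar> \<le> 3/4" "\<bar>t\<bar> \<le> 3/4"
  shows "P s * N t = 0" "N t * P s = 0"
proof -
  note c = contraction_shift[OF assms(2)] contraction_shift[OF assms(3)]
  show 1: "P s * N t = 0"
    using assms by (intro pos_neg_orthogonal[where r = "s - t"] c) (simp_all add: algebra_simps)
  show "N t * P s = 0"
    unfolding 1[symmetric] by (intro pos_neg_commute[symmetric] c) (simp add: algebra_simps)
qed

text \<open>
  The ramp is $0$ below $u$ and $1$ above $t$, so it is a local unit for $(h - s)_+$ if
  $s \<ge> t$. Algebraically, $P_u - P_t = (t - u) + N_u - N_t$, and $P_s$ annihilates both negative parts.
\<close>

lemma pos_ramp:
  assumes "u < t" "t \<le> s" "\<bar>s\<bar> \<le> 3/4" "\<bar>u\<bar> \<le> 3/4"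
  shows "P s * ((1 / (t - u)) *\<^sub>R (P u - P t)) = P s" "((1 / (t - u)) *\<^sub>R (P u - P t)) * P s = P s"
proof -
  have t: "\<bar>t\<bar> \<le> 3/4" using assms by simp
  have Pu: "P u = h - u *\<^sub>R 1 + N u" and Pt: "P t = h - t *\<^sub>R 1 + N t"
    using pos_minus_neg[of "h - u *\<^sub>R 1"] pos_minus_neg[of "h - t *\<^sub>R 1"]
    by (simp_all add: algebra_simps)
  have diff: "P u - P t = (t - u) *\<^sub>R 1 + N u - N t"
    unfolding Pu Pt by (simp add: algebra_simps)
  note 0 = pos_neg_shift[OF _ \<open>\<bar>s\<bar> \<le> 3/4\<close> t] pos_neg_shift[OF _ \<open>\<bar>s\<bar> \<le> 3/4\<close> \<open>\<bar>u\<bar> \<le> 3/4\<close>]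
  show "P s * ((1 / (t - u)) *\<^sub>R (P u - P t)) = P s"
    unfolding diff using 0 assms by (simp add: distrib_left right_diff_distrib flip: diff_divide_distrib)
  show "((1 / (t - u)) *\<^sub>R (P u - P t)) * P s = P s"
    unfolding diff using 0 assms by (simp add: distrib_right left_diff_distrib flip: diff_divide_distrib)
qed

text \<open>
  Cut $[u,s]$ into $n + 1$ equal pieces and let $e_i$ be the ramp of the $i$-th piece, counted from the
  top. Then $P_s = P_s e_0$ shows $e_0 \<noteq> 0$, and $e_n N_u = 0$ shows $e_n \<noteq> 1$.
\<close>

lemma ramp_chain:
  assumes "u < s" "\<bar>s\<bar> \<le> 3/4" "\<bar>u\<bar> \<le> 3/4" and Ps: "P s \<noteq> 0" and Nu: "N u \<noteq> 0"
  shows "\<exists>e :: nat \<Rightarrow> 'a. (\<forall>i j. i < j \<longrightarrow> j \<le> n \<longrightarrow> e i * e j = e i \<and> e j * e i = e i)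
    \<and> e 0 \<noteq> 0 \<and> e n \<noteq> 1"
proof -
  define d where "d = (s - u) / (real n + 1)"
  define t where "t i = s - real i * d" for i :: nat
  have d: "d > 0" using \<open>u < s\<close> by (simp add: d_def)
  have t0: "t 0 = s" by (simp add: t_def)
  have tn: "t (Suc n) = u" by (simp add: t_def d_def add.commute)
  have t_mono: "t j \<le> t i" if "i \<le> j" for i j using that d by (simp add: t_def)
  have t_diff: "t i - t (Suc i) = d" for i by (simp add: t_def algebra_simps)
  have t_less: "t (Suc i) < t i" for i using t_diff[of i] d by simp
  have t_bound: "\<bar>t i\<bar> \<le> 3/4" if "i \<le> Suc n" for i
    using t_mono[of 0 i] t_mono[of i "Suc n"] that assms unfolding t0 tn by simp
  define e where "e i = (1 / (t i - t (Suc i))) *\<^sub>R (P (t (Suc i)) - P (t i))" for i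
  have Pe: "P (t i) * e j = P (t i)" "e j * P (t i) = P (t i)" if "i \<le> j" "j \<le> n" for i j
    unfolding e_def using that by (intro pos_ramp t_less t_mono t_bound; simp)+
  have "e i * e j = e i" "e j * e i = e i" if "i < j" "j \<le> n" for i j
  proof -
    have "i \<le> j" "Suc i \<le> j" using that by simp_all
    note Pe = Pe[OF this(1) that(2)] Pe[OF this(2) that(2)]
    show "e i * e j = e i"
      unfolding e_def[of i] by (simp only: mult_scaleR_left left_diff_distrib Pe)
    show "e j * e i = e i"
      unfolding e_def[of i] by (simp only: mult_scaleR_right right_diff_distrib Pe)
  qed
  moreover have "e 0 \<noteq> 0" using Pe(1)[of 0 0] Ps by (auto simp: t0)
  moreover have "e n \<noteq> 1"
  proof
    assume "e n = 1"
    have "P (t (Suc n)) * N (t (Suc n)) = 0" "P (t n) * N (t (Suc n)) = 0"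
      by (intro pos_neg_shift t_bound t_mono; simp)+
    then have "e n * N u = 0" by (simp add: e_def left_diff_distrib flip: tn)
    then show False using Nu \<open>e n = 1\<close> by simp
  qed
  ultimately show ?thesis by blast
qed

lemma continuous_on_cabs_shift: "continuous_on {-3/4..3/4} (\<lambda>s. cabs (h - s *\<^sub>R 1))"
  unfolding cabs_def
proof (rule continuous_on_compose2[OF continuous_on_sqrt_one_minus])
  show "(\<lambda>s. 1 - (h - s *\<^sub>R 1) * (h - s *\<^sub>R 1)) ` {-3/4..3/4} \<subseteq> cball 0 1"
  proof (rule image_subsetI)
    fix s :: real assume "s \<in> {-3/4..3/4}"
    then have "contraction_sa (h - s *\<^sub>R 1)" by (intro contraction_shift) auto
    then show "1 - (h - s *\<^sub>R 1) * (h - s *\<^sub>R 1) \<in> cball 0 1"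
      unfolding contraction_sa_def using norm_one_minus_square_le by auto
  qed
qed (intro continuous_intros)

lemma continuous_on_pos: "continuous_on {-3/4..3/4} P"
  unfolding pos_part_def by (intro continuous_intros continuous_on_cabs_shift)

lemma continuous_on_neg: "continuous_on {-3/4..3/4} N"
  unfolding neg_part_def by (intro continuous_intros continuous_on_cabs_shift)

lemma pos_nonzero: "P (-1/2) \<noteq> 0"
proof
  assume "P (-1/2) = 0"
  then have "cabs (h - (-1/2) *\<^sub>R 1) = - (h - (-1/2) *\<^sub>R 1)"
    by (simp add: pos_part_def add_eq_0_iff2)
  then have "1 - cabs (h - (-1/2) *\<^sub>R 1) = (3/2) *\<^sub>R 1 - (- h)"
    using scaleR_left_distrib[of 1 "1/2" "1::'a"] by simp
  moreover have "norm (1 - cabs (h - (-1/2) *\<^sub>R 1)) \<le> 1"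
    by (intro norm_one_minus_cabs_le contraction_shift) simp
  ultimately have "norm ((3/2) *\<^sub>R (1::'a) - (- h)) \<le> 1" by (simp only:)
  then show False using norm_triangle_ineq2[of "(3/2) *\<^sub>R (1::'a)" "- h"] norm_h by simp
qed

lemma neg_nonzero: "N (1/2) \<noteq> 0"
proof
  assume "N (1/2) = 0"
  then have "cabs (h - (1/2) *\<^sub>R 1) = h - (1/2) *\<^sub>R 1"
    by (simp add: neg_part_def)
  moreover have "norm (1 - cabs (h - (1/2) *\<^sub>R 1)) \<le> 1"
    by (intro norm_one_minus_cabs_le contraction_shift) simp
  moreover have "1 - (h - (1/2) *\<^sub>R 1) = (3/2) *\<^sub>R 1 - h"
    using scaleR_left_distrib[of 1 "1/2" "1::'a"] by simp
  ultimately have "norm ((3/2) *\<^sub>R (1::'a) - h) \<le> 1" by simp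
  then show False using norm_triangle_ineq2[of "(3/2) *\<^sub>R (1::'a)" h] norm_h by simp
qed

text \<open>
  Otherwise $[-1/2, 1/2]$ is covered by the closed sets where $P$ and where $N$ vanishes. Both are
  nonempty, so by connectedness they meet in some $s$, and there $h - s = P_s - N_s = 0$.
\<close>

lemma threshold_with_both_parts:
  assumes nonscalar: "\<And>s. h \<noteq> s *\<^sub>R 1"
  obtains s where "-1/2 \<le> s" "s \<le> 1/2" "P s \<noteq> 0" "N s \<noteq> 0"
proof -
  let ?I = "{-1/2..1/2::real}"
  let ?A = "{s \<in> ?I. P s = 0}" and ?B = "{s \<in> ?I. N s = 0}"
  have "\<exists>s\<in>?I. P s \<noteq> 0 \<and> N s \<noteq> 0"
  proof (rule ccontr)
    assume "\<not> ?thesis"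
    then have "?I \<subseteq> ?A \<union> ?B" by auto
    moreover have "closed ?A" "closed ?B"
      by (intro continuous_closed_preimage_constant continuous_on_subset[OF continuous_on_pos]
          continuous_on_subset[OF continuous_on_neg]; force)+
    moreover have "?A \<inter> ?B \<inter> ?I = {}"
    proof (intro equals0I)
      fix s assume "s \<in> ?A \<inter> ?B \<inter> ?I"
      then have "h - s *\<^sub>R 1 = 0" using pos_minus_neg[of "h - s *\<^sub>R 1"] by simp
      then show False using nonscalar[of s] by simp
    qed
    ultimately have "?A \<inter> ?I = {} \<or> ?B \<inter> ?I = {}"
      by (intro connected_closedD connected_Icc)
    moreover have "-1/2 \<in> ?A \<union> ?B" "1/2 \<in> ?A \<union> ?B"
      by (rule subsetD[OF \<open>?I \<subseteq> ?A \<union> ?B\<close>]; simp)+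
    then have "-1/2 \<in> ?B" "1/2 \<in> ?A" using pos_nonzero neg_nonzero by blast+
    moreover have "-1/2 \<in> ?I" "1/2 \<in> ?I" by simp_all
    ultimately show False by blast
  qed
  then show ?thesis using that by auto
qed

text \<open>
  By continuity, $P$ stays nonzero slightly above a threshold where both parts are nonzero, and
  $N$ slightly below it. This opens an interval for \<open>ramp_chain\<close>.
\<close>

lemma chain_exists:
  assumes nonscalar: "\<And>s. h \<noteq> s *\<^sub>R 1"
  shows "\<exists>e :: nat \<Rightarrow> 'a. (\<forall>i j. i < j \<longrightarrow> j \<le> n \<longrightarrow> e i * e j = e i \<and> e j * e i = e i)
    \<and> e 0 \<noteq> 0 \<and> e n \<noteq> 1"
proof -
  obtain s where s: "-1/2 \<le> s" "s \<le> 1/2" "P s \<noteq> 0" "N s \<noteq> 0"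
    using threshold_with_both_parts[OF nonscalar] .
  have near: "\<exists>d>0. \<forall>r. r \<noteq> s \<and> dist r s < d \<longrightarrow> F r \<noteq> 0"
    if "continuous_on {-3/4..3/4} F" "F s \<noteq> 0" for F :: "real \<Rightarrow> 'a"
  proof -
    have "s \<in> interior {-3/4..3/4}" using s by simp
    then have "isCont F s" by (rule continuous_on_interior[OF that(1)])
    then have "\<forall>\<^sub>F r in at s. F r \<noteq> 0"
      using \<open>F s \<noteq> 0\<close> by (intro tendsto_imp_eventually_ne[of F "F s"]) (auto simp: isCont_def)
    then show ?thesis by (auto simp: eventually_at)
  qed
  obtain d1 where d1: "d1 > 0" "\<And>r. r \<noteq> s \<Longrightarrow> dist r s < d1 \<Longrightarrow> P r \<noteq> 0"
    using near[OF continuous_on_pos \<open>P s \<noteq> 0\<close>] by blast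
  obtain d2 where d2: "d2 > 0" "\<And>r. r \<noteq> s \<Longrightarrow> dist r s < d2 \<Longrightarrow> N r \<noteq> 0"
    using near[OF continuous_on_neg \<open>N s \<noteq> 0\<close>] by blast
  define d where "d = min (min d1 d2) (1/4) / 2"
  have d: "d > 0" "d < d1" "d < d2" "d \<le> 1/4" using d1 d2 by (auto simp: d_def)
  show ?thesis
  proof (rule ramp_chain)
    show "s - d < s + d" using d by simp
    show "\<bar>s + d\<bar> \<le> 3/4" using d s by linarith
    show "\<bar>s - d\<bar> \<le> 3/4" using d s by linarith
    show "P (s + d) \<noteq> 0" using d by (intro d1) (auto simp: dist_real_def)
    show "N (s - d) \<noteq> 0" using d by (intro d2) (auto simp: dist_real_def)
  qed
qed

end

section \<open>Simple C*-algebras\<close>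

lemma invertible_near_one:
  fixes y :: "'a::{real_normed_algebra_1,banach}"
  assumes "norm (1 - y) < 1"
  obtains z where "z * y = 1"
proof
  define x where "x = 1 - y"
  have sm: "summable (\<lambda>n. x ^ n)"
    using assms by (intro complete_algebra_summable_geometric) (simp add: x_def)
  have "(\<Sum>n. x ^ n) * x = (\<Sum>n. x ^ Suc n)"
    using suminf_mult2[OF sm, of x] by (simp add: power_commutes)
  also have "\<dots> = (\<Sum>n. x ^ n) - 1" using suminf_split_head[OF sm] by simp
  finally show "(\<Sum>n. x ^ n) * y = 1" by (simp add: x_def algebra_simps)
qed

text \<open>
  Simplicity with respect to closed ideals implies algebraic simplicity: a dense ideal contains an element
  near $1$, and such an element is left invertible by the Neumann series.
\<close>

lemma simple_cstar_algebra_is_simple: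
  assumes simple: "simple_cstar_algebra TYPE('a::unital_cstar_algebra)"
  shows "simple_algebra TYPE('a)"
proof
  fix I :: "'a set" assume I: "ring_ideal I"
  have scale: "c *\<^sub>C x \<in> I" if "x \<in> I" for c x
  proof -
    have "c *\<^sub>C x = (c *\<^sub>C 1) * x" by (simp add: mult_scaleC_left)
    then show ?thesis using I that by (simp add: ring_ideal_def)
  qed
  have closureE: "\<exists>f. (\<forall>n. f n \<in> I) \<and> f \<longlonglongrightarrow> x" if "x \<in> closure I" for x
    using that by (simp add: closure_sequential)
  have ideal: "two_sided_ideal (closure I)"
    unfolding two_sided_ideal_def
  proof (intro conjI ballI allI complex_vector.subspaceI)
    show "0 \<in> closure I" using I closure_subset by (auto simp: ring_ideal_def)
  next
    fix x y assume "x \<in> closure I" "y \<in> closure I"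
    then obtain f g where "\<forall>n. f n \<in> I" "f \<longlonglongrightarrow> x" "\<forall>n. g n \<in> I" "g \<longlonglongrightarrow> y"
      using closureE by meson
    then show "x + y \<in> closure I"
      unfolding closure_sequential using I
      by (intro exI[of _ "\<lambda>n. f n + g n"]) (auto simp: ring_ideal_def intro: tendsto_add)
  next
    fix x a assume "x \<in> closure I"
    then obtain f where f: "\<forall>n. f n \<in> I" "f \<longlonglongrightarrow> x" using closureE by meson
    show "a * x \<in> closure I"
      unfolding closure_sequential using I f
      by (intro exI[of _ "\<lambda>n. a * f n"]) (auto simp: ring_ideal_def intro: tendsto_intros)
    show "x * a \<in> closure I"
      unfolding closure_sequential using I f
      by (intro exI[of _ "\<lambda>n. f n * a"]) (auto simp: ring_ideal_def intro: tendsto_intros)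
  next
    fix c x assume "x \<in> closure I"
    then obtain f where f: "\<forall>n. f n \<in> I" "f \<longlonglongrightarrow> x" using closureE by meson
    have "(\<lambda>n. (c *\<^sub>C 1) * f n) \<longlonglongrightarrow> (c *\<^sub>C 1) * x" by (intro tendsto_intros f)
    then have "(\<lambda>n. c *\<^sub>C f n) \<longlonglongrightarrow> c *\<^sub>C x" by (simp add: mult_scaleC_left)
    then show "c *\<^sub>C x \<in> closure I"
      unfolding closure_sequential using f scale by (intro exI[of _ "\<lambda>n. c *\<^sub>C f n"]) auto
  qed
  then consider "closure I = {0}" | "closure I = UNIV"
    using simple unfolding simple_cstar_algebra_def by blast
  then show "I = {0} \<or> I = UNIV"
  proof cases
    case 1
    then have "I \<subseteq> {0}" using closure_subset by metis
    then show ?thesis using I by (auto simp: ring_ideal_def)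
  next
    case 2
    then have "1 \<in> closure I" by simp
    then obtain y where y: "y \<in> I" "dist y 1 < 1"
      unfolding closure_approachable using zero_less_one by blast
    then have "norm (1 - y) < 1" by (simp add: dist_norm norm_minus_commute)
    then obtain z where "z * y = 1" by (rule invertible_near_one)
    then have "1 \<in> I" using I y unfolding ring_ideal_def by metis
    then have "a \<in> I" for a using I unfolding ring_ideal_def by (metis mult.right_neutral)
    then show ?thesis by auto
  qed
qed

text \<open>
  If all self-adjoint elements were scalars, then the real and imaginary parts of $a$ would be, and $a$ would
  be central.
\<close>

lemma nonscalar_self_adjoint:
  fixes a b :: "'a::unital_cstar_algebra"
  assumes "comm a b \<noteq> 0"
  obtains h :: 'a where "star h = h" "norm h \<le> 1/4" "\<And>s. h \<noteq> s *\<^sub>R 1"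
proof -
  have "\<exists>k::'a. star k = k \<and> (\<forall>s. k \<noteq> s *\<^sub>R 1)"
  proof (rule ccontr)
    assume *: "\<not> ?thesis"
    then have sa: "\<exists>s. k = s *\<^sub>R 1" if "star k = k" for k :: 'a using that by blast
    have "star (a + star a) = a + star a" by (simp add: star_add star_star add.commute)
    then obtain r where r: "a + star a = r *\<^sub>R 1" using sa by blast
    have "star (\<i> *\<^sub>C (a - star a)) = \<i> *\<^sub>C (a - star a)"
      by (simp add: star_scaleC star_diff star_star complex_vector.scale_minus_left
          flip: complex_vector.scale_minus_right)
    then obtain t where t: "\<i> *\<^sub>C (a - star a) = t *\<^sub>R 1" using sa by blast
    have "(-\<i>) *\<^sub>C (\<i> *\<^sub>C (a - star a)) = a - star a" by (simp only: scaleC_scaleC) simp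
    then have "a - star a = t *\<^sub>R ((-\<i>) *\<^sub>C 1)"
      unfolding t by (simp add: scaleC_scaleC mult.commute flip: scaleC_of_real)
    then have "(a + star a) + (a - star a) = r *\<^sub>R 1 + t *\<^sub>R ((-\<i>) *\<^sub>C 1)"
      using r by (simp only:)
    then have "2 *\<^sub>R a = r *\<^sub>R 1 + t *\<^sub>R ((-\<i>) *\<^sub>C 1)" by (simp add: scaleR_2)
    then have "comm (2 *\<^sub>R a) b = comm (r *\<^sub>R 1 + t *\<^sub>R ((-\<i>) *\<^sub>C 1)) b"
      by (simp only:)
    also have "\<dots> = 0"
      by (simp add: comm_def algebra_simps mult_scaleC_left mult_scaleC_right)
    finally have "comm (2 *\<^sub>R a) b = 0" .
    then have "2 *\<^sub>R comm a b = 0" by (simp add: comm_def scaleR_diff_right)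
    then show False using assms by simp
  qed
  then obtain k :: 'a where k: "star k = k" "\<And>s. k \<noteq> s *\<^sub>R 1" by blast
  have "k \<noteq> 0" using k(2)[of 0] by simp
  show ?thesis
  proof
    let ?c = "1 / (4 * norm k)"
    show "star (?c *\<^sub>R k) = ?c *\<^sub>R k" by (simp add: star_scaleR k)
    show "norm (?c *\<^sub>R k) \<le> 1/4" using \<open>k \<noteq> 0\<close> by simp
    show "?c *\<^sub>R k \<noteq> s *\<^sub>R 1" for s
    proof
      assume "?c *\<^sub>R k = s *\<^sub>R 1"
      then have "(4 * norm k) *\<^sub>R ?c *\<^sub>R k = ((4 * norm k) * s) *\<^sub>R 1" by simp
      then show False using k(2) \<open>k \<noteq> 0\<close> by simp
    qed
  qed
qed

lemma commutators_in_span_square_zero_cstar: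
  assumes simple: "simple_cstar_algebra TYPE('a::unital_cstar_algebra)"
  shows "comm a b \<in> span {x::'a. x * x = 0}"
proof (cases "\<forall>c d::'a. comm c d = 0")
  case True
  then show ?thesis by (simp add: span_zero)
next
  case False
  then obtain h :: 'a where h: "star h = h" "norm h \<le> 1/4" "\<And>s. h \<noteq> s *\<^sub>R 1"
    using nonscalar_self_adjoint by metis
  obtain e :: "nat \<Rightarrow> 'a" where
    "\<And>i j. i < j \<Longrightarrow> j \<le> 8 \<Longrightarrow> e i * e j = e i \<and> e j * e i = e i" "e 0 \<noteq> 0" "e 8 \<noteq> 1"
    using chain_exists[OF h, of 8] by blast
  then show ?thesis
    by (rule simple_algebra.commutators_in_span_square_zero[OF simple_cstar_algebra_is_simple[OF simple]])
qed

lemma subspace_if_csubspace: "csubspace U \<Longrightarrow> subspace U"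
  unfolding complex_vector.subspace_def subspace_def by (metis scaleC_of_real)

lemma conj_expand: "(1 + x) * u * (1 - x) = u - comm u x - x * u * x"
  for x u :: "'a::ring_1"
  by (simp add: comm_def algebra_simps)

theorem corollary4p6:
  fixes U :: "'a::unital_cstar_algebra set"
  assumes "simple_cstar_algebra TYPE('a)"
    and "csubspace U"
  shows "lie_ideal U \<longleftrightarrow> (\<forall>x\<in>N2. (\<lambda>u. (1 + x) * u * (1 - x)) ` U \<subseteq> U)"
proof
  have U: "subspace U" using assms(2) by (rule subspace_if_csubspace)
  {
    assume "lie_ideal U"
    then have lie: "comm u a \<in> U" if "u \<in> U" for u a
      using that by (simp add: lie_ideal_def comm_def)
    have "(1 + x) * u * (1 - x) \<in> U" if "u \<in> U" "x \<in> N2" for u x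
    proof -
      have "x * x = 0" using \<open>x \<in> N2\<close> by (simp add: N2_def power2_eq_square)
      then have "comm (comm u x) x = - (2 *\<^sub>R (x * u * x))"
        by (simp add: comm_def algebra_simps scaleR_2) (simp flip: mult.assoc)
      then have "x * u * x = (- (1/2)) *\<^sub>R comm (comm u x) x" by simp
      then have "x * u * x \<in> U" using lie that(1) U by (simp add: subspace_scale subspace_neg)
      then show ?thesis unfolding conj_expand using lie that(1) U by (intro subspace_diff)
    qed
    then show "\<forall>x\<in>N2. (\<lambda>u. (1 + x) * u * (1 - x)) ` U \<subseteq> U" by blast
  }
  {
    assume inv: "\<forall>x\<in>N2. (\<lambda>u. (1 + x) * u * (1 - x)) ` U \<subseteq> U"
    have "comm u x \<in> U" if "u \<in> U" "x * x = 0" for u x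
    proof (cases "x = 0")
      case True
      then show ?thesis using U by (simp add: comm_def subspace_0)
    next
      case False
      then have "x \<in> N2" "- x \<in> N2" using that(2) by (simp_all add: N2_def power2_eq_square)
      then have "(1 + x) * u * (1 - x) \<in> U" "(1 + - x) * u * (1 - - x) \<in> U"
        using inv \<open>u \<in> U\<close> by blast+
      then have "(1/2) *\<^sub>R ((1 + - x) * u * (1 - - x) - (1 + x) * u * (1 - x)) \<in> U"
        using U by (intro subspace_scale subspace_diff)
      moreover have "(1 + - x) * u * (1 - - x) - (1 + x) * u * (1 - x) = 2 *\<^sub>R comm u x"
        unfolding conj_expand by (simp add: comm_def algebra_simps scaleR_2)
      ultimately show ?thesis by simp
    qed
    then consider "\<forall>u\<in>U. \<forall>a. comm u a = 0" | "\<forall>a b. comm a b \<in> U"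
      using simple_algebra.central_or_contains_commutators[OF
          simple_cstar_algebra_is_simple[OF assms(1)] U _
          commutators_in_span_square_zero_cstar[OF assms(1)]] by blast
    then show "lie_ideal U"
      unfolding lie_ideal_def using assms(2) U
      by cases (auto simp: comm_def subspace_0)
  }
qed

end
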